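(* Let $\mathcal X$ be a finite set. There exists a sequence of distributions $\{U^n_{X^n}\}_{n\in\mathbb N}$ with $U^n_{X^n}\in\mathcal P^{\rm sym}(\mathcal X^n)$ such that, for every $n\in\mathbb N$ and every $Q_{X^n}\in\mathcal P^{\rm sym}(\mathcal X^n)$, $$Q_{X^n}(x^n)\le|\mathcal T_n(\mathcal X)|\,U^n_{X^n}(x^n)\qquad\text{for all }x^n\in\mathcal X^n.$$
   Context: $\mathcal P^{\rm sym}(\mathcal X^n)$ is the set of probability mass functions on $\mathcal X^n$ that are invariant under all permutations of the $n$ coordinates. $\mathcal T_n(\mathcal X)$ is the set of $\mathcal X$-types of length $n$, i.e. of the empirical distributions of sequences $x^n\in\mathcal X^n$. *)

theory Defs
  imports "HOL-Probability.Probability" "HOL-Combinatorics.Permutations" "HOL-Library.NList"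
begin

text \<open>
  A sequence \<open>x\<^sup>n \<in> X\<^sup>n\<close> is a list in \<^term>\<open>nlists n X\<close>. A mass function on \<open>X\<^sup>n\<close> is a
  \<^typ>\<open>'a list pmf\<close> whose support lies in that set.
\<close>

definition sym_pmfs :: "nat \<Rightarrow> 'a set \<Rightarrow> 'a list pmf set" where
  "sym_pmfs n X = {Q. set_pmf Q \<subseteq> nlists n X \<and>
     (\<forall>\<pi>. \<pi> permutes {..<n} \<longrightarrow>
        (\<forall>xs\<in>nlists n X. pmf Q (permute_list \<pi> xs) = pmf Q xs))}"

text \<open>
  The value of \<open>empirical []\<close> is unspecified. So \<open>types 0 X\<close> is a singleton
  whose element carries no meaning.
\<close>

definition empirical :: "'a list \<Rightarrow> 'a pmf" where
  "empirical xs = pmf_of_multiset (mset xs)"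

lemma pmf_empirical:
  assumes "xs \<noteq> []"
  shows "pmf (empirical xs) a = real (count_list xs a) / real (length xs)"
  using assms by (simp add: empirical_def count_mset)

definition types :: "nat \<Rightarrow> 'a set \<Rightarrow> 'a pmf set" where
  "types n X = empirical ` nlists n X"

end

theory Submission
  imports Defs
begin

text \<open>
  Take \<open>U n\<close> to be the uniform mixture, over all types, of the uniform distributions on the type
  classes. A symmetric \<open>Q\<close> is constant on each type class, so its value there is at most the
  reciprocal of the size of the class.
\<close>

text \<open>Together with \<open>nlists_def\<close>, these conditional simp rules make the simplifier loop.\<close>
declare nlistsE_length [simp del] nlistsE_set [simp del]

text \<open>The type class of \<open>t\<close>; it is empty unless \<open>t\<close> lies in
  \<open>types n X\<close>.\<close>

definition seqs_of_type :: "nat \<Rightarrow> 'a set \<Rightarrow> 'a pmf \<Rightarrow> 'a list set" where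
  "seqs_of_type n X t = {xs \<in> nlists n X. empirical xs = t}"

definition type_mixture :: "nat \<Rightarrow> 'a set \<Rightarrow> 'a list pmf" where
  "type_mixture n X = pmf_of_set (types n X) \<bind> (\<lambda>t. pmf_of_set (seqs_of_type n X t))"

lemma finite_nlists:
  assumes "finite X"
  shows "finite (nlists n X)"
proof -
  have "nlists n X = {xs. set xs \<subseteq> X \<and> length xs = n}"
    unfolding nlists_def by (rule Collect_cong) (rule conj_commute)
  then show ?thesis
    by (simp only: finite_lists_length_eq[OF assms])
qed

text \<open>With equal lengths the frequencies share a denominator, so equal frequencies force equal
  counts. Empty lists are treated apart, since \<open>empirical []\<close> is unspecified; there the
  lengths alone decide.\<close>

lemma empirical_eq_imp_mset_eq:
  assumes "length xs = length ys" and "empirical xs = empirical ys"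
  shows "mset xs = mset ys"
proof (cases "xs = []")
  case True
  then show ?thesis using assms by simp
next
  case False
  then have ys: "ys \<noteq> []" using assms by auto
  show ?thesis
  proof (rule multiset_eqI)
    fix a
    have "real (count_list xs a) / real (length xs) = real (count_list ys a) / real (length xs)"
      using pmf_empirical[OF False, of a] pmf_empirical[OF ys, of a] assms by metis
    then show "count (mset xs) a = count (mset ys) a"
      using False by (simp add: count_mset)
  qed
qed

lemma permute_list_in_nlists_iff:
  assumes "\<pi> permutes {..<n}" and "length xs = n"
  shows "permute_list \<pi> xs \<in> nlists n X \<longleftrightarrow> xs \<in> nlists n X"
  using assms by (simp add: nlists_def)

text \<open>\<open>empirical\<close> sees only the multiset of entries, which a permutation of
  positions preserves.\<close>

lemma permute_list_in_seqs_of_type_iff: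
  assumes "\<pi> permutes {..<n}" and "length xs = n"
  shows "permute_list \<pi> xs \<in> seqs_of_type n X t \<longleftrightarrow> xs \<in> seqs_of_type n X t"
  using assms by (simp add: seqs_of_type_def permute_list_in_nlists_iff empirical_def)

text \<open>Sequences of the same type are rearrangements of each other, so the symmetry of
  \<open>Q\<close> applies.\<close>

lemma sym_pmf_constant_on_seqs_of_type:
  assumes "Q \<in> sym_pmfs n X" and "xs \<in> seqs_of_type n X t" and "ys \<in> seqs_of_type n X t"
  shows "pmf Q xs = pmf Q ys"
proof -
  have "mset xs = mset ys"
    using assms by (intro empirical_eq_imp_mset_eq) (auto simp: seqs_of_type_def nlists_def)
  then obtain \<pi> where "\<pi> permutes {..<length ys}" and "permute_list \<pi> ys = xs"
    by (rule mset_eq_permutation)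
  then show ?thesis
    using assms by (auto simp: sym_pmfs_def seqs_of_type_def nlists_def)
qed

lemma sym_pmf_le_inverse_card_seqs_of_type:
  assumes "finite X" and "Q \<in> sym_pmfs n X" and xs: "xs \<in> seqs_of_type n X t"
  shows "pmf Q xs \<le> 1 / real (card (seqs_of_type n X t))"
proof -
  have fin: "finite (seqs_of_type n X t)"
    using finite_nlists[OF \<open>finite X\<close>] by (simp add: seqs_of_type_def)
  then have pos: "card (seqs_of_type n X t) > 0"
    using xs by (auto simp: card_gt_0_iff)
  \<comment> \<open>Class size times the common value is the mass that \<open>Q\<close> gives to the
    class, hence at most 1.\<close>
  have "real (card (seqs_of_type n X t)) * pmf Q xs = (\<Sum>ys\<in>seqs_of_type n X t. pmf Q xs)"
    by simp
  also have "\<dots> = (\<Sum>ys\<in>seqs_of_type n X t. pmf Q ys)"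
    using assms by (intro sum.cong refl sym_pmf_constant_on_seqs_of_type)
  also have "\<dots> = measure_pmf.prob Q (seqs_of_type n X t)"
    using fin by (simp add: measure_measure_pmf_finite)
  also have "\<dots> \<le> 1" by simp
  finally show ?thesis using pos by (simp add: field_simps)
qed

context
  fixes X :: "'a set"
  assumes fin: "finite X" and ne: "X \<noteq> {}"
begin

lemma finite_types: "finite (types n X)"
  using finite_nlists[OF fin] by (simp add: types_def)

text \<open>Here \<open>X \<noteq> {}\<close> matters: over an empty alphabet and for positive
  \<open>n\<close> there are no sequences, hence no types to mix.\<close>

lemma types_nonempty: "types n X \<noteq> {}"
  using nlists_not_empty[OF ne, of n] by (auto simp: types_def)

lemma finite_seqs_of_type: "finite (seqs_of_type n X t)"
  using finite_nlists[OF fin] by (simp add: seqs_of_type_def)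

lemma seqs_of_type_nonempty: "t \<in> types n X \<Longrightarrow> seqs_of_type n X t \<noteq> {}"
  by (auto simp: types_def seqs_of_type_def)

text \<open>The factor clears the uniform weight on the types. Only the summand for the type of
  \<open>xs\<close> can be nonzero. Both the symmetry of the mixture and the final bound are read
  off from this formula.\<close>

lemma card_types_mult_pmf_type_mixture:
  "real (card (types n X)) * pmf (type_mixture n X) xs =
     (\<Sum>t\<in>types n X. indicator (seqs_of_type n X t) xs / real (card (seqs_of_type n X t)))"
proof -
  have "real (card (types n X)) * pmf (type_mixture n X) xs =
      (\<Sum>t\<in>types n X. pmf (pmf_of_set (seqs_of_type n X t)) xs)"
    using finite_types types_nonempty
    by (simp add: type_mixture_def pmf_bind_pmf_of_set)
  also have "\<dots> = (\<Sum>t\<in>types n X. indicator (seqs_of_type n X t) xs / real (card (seqs_of_type n X t)))"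
    by (intro sum.cong refl pmf_of_set seqs_of_type_nonempty finite_seqs_of_type)
  finally show ?thesis .
qed

lemma type_mixture_in_sym_pmfs: "type_mixture n X \<in> sym_pmfs n X"
proof -
  have "set_pmf (type_mixture n X) \<subseteq> nlists n X"
    using finite_types types_nonempty finite_seqs_of_type seqs_of_type_nonempty
    by (simp add: type_mixture_def UN_subset_iff seqs_of_type_def)
  moreover have "pmf (type_mixture n X) (permute_list \<pi> xs) = pmf (type_mixture n X) xs"
    if "\<pi> permutes {..<n}" and "xs \<in> nlists n X" for \<pi> xs
  proof -
    \<comment> \<open>Each type class is closed under permutations, so every summand of the formula
      is invariant.\<close>
    have "indicator (seqs_of_type n X t) (permute_list \<pi> xs) = (indicator (seqs_of_type n X t) xs :: real)"
      for t
      using that by (simp add: indicator_def permute_list_in_seqs_of_type_iff nlists_def)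
    then have "real (card (types n X)) * pmf (type_mixture n X) (permute_list \<pi> xs) =
        real (card (types n X)) * pmf (type_mixture n X) xs"
      by (simp only: card_types_mult_pmf_type_mixture)
    \<comment> \<open>There is at least one type, so the common factor cancels.\<close>
    then show ?thesis
      using finite_types types_nonempty by simp
  qed
  ultimately show ?thesis by (simp add: sym_pmfs_def)
qed

lemma sym_pmf_le_card_types_mult_type_mixture:
  assumes "Q \<in> sym_pmfs n X" and "xs \<in> nlists n X"
  shows "pmf Q xs \<le> real (card (types n X)) * pmf (type_mixture n X) xs"
proof -
  let ?t = "empirical xs"
  have xs: "xs \<in> seqs_of_type n X ?t" and t: "?t \<in> types n X"
    using assms by (auto simp: seqs_of_type_def types_def)
  have "pmf Q xs \<le> indicator (seqs_of_type n X ?t) xs / real (card (seqs_of_type n X ?t))"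
    using sym_pmf_le_inverse_card_seqs_of_type[OF fin assms(1) xs] xs by simp
  \<comment> \<open>All summands are nonnegative, so the one for \<open>?t\<close> is a lower bound
    for the sum.\<close>
  also have "\<dots> \<le> (\<Sum>t\<in>types n X. indicator (seqs_of_type n X t) xs / real (card (seqs_of_type n X t)))"
    using t finite_types
    by (intro member_le_sum[of ?t "types n X"
          "\<lambda>t. indicator (seqs_of_type n X t) xs / real (card (seqs_of_type n X t))"]) auto
  finally show ?thesis by (simp only: card_types_mult_pmf_type_mixture)
qed

end

theorem lemma14:
  fixes X :: "'a set"
  assumes "finite X" and "X \<noteq> {}"
  shows "\<exists>U :: nat \<Rightarrow> 'a list pmf.
    (\<forall>n. U n \<in> sym_pmfs n X) \<and>
    (\<forall>n. \<forall>Q \<in> sym_pmfs n X. \<forall>xs \<in> nlists n X.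
       pmf Q xs \<le> real (card (types n X)) * pmf (U n) xs)"
  using type_mixture_in_sym_pmfs[OF assms] sym_pmf_le_card_types_mult_type_mixture[OF assms]
  by (intro exI[of _ "\<lambda>n. type_mixture n X"] conjI allI ballI)

end
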